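(* Let $\Lambda$ be an at most countable index set, $Y$ a Hilbert space, and let $F\colon\ell^2(\Lambda)\to Y$ be a bounded linear operator with dense range. Let $0<p<2$. Then: (1) (Existence) For every $\beta>0$ and $y\in Y$, the set of regularized solutions $\Sigma(F,y,\beta)$ is non-empty. (2) (Stability) Let $(\beta_k)$ and $(y_k)$ be sequences with $\beta_k\to\beta>0$ and $y_k\to y\in Y$. Then \[ \emptyset\ne\tau_p\text{-}\limsup_{k\to\infty}\Sigma(F,y_k,\beta_k)\subset\Sigma(F,y,\beta). \] (3) (Convergence) Let $\|y_k-y\|\le\beta_k\to0$ and assume that the equation $Fx=y$ has a solution in $\ell^p(\Lambda)$. Then \[ \emptyset\ne\tau_p\text{-}\limsup_{k\to\infty}\Sigma(F,y_k,\beta_k)\subset\Sigma(F,y,0). \] Moreover, if the equation $Fx=y$ has a unique $\mathcal R_p$-minimizing solution $x^\dagger$ (that is, $\Sigma(F,y,0)=\{x^\dagger\}$), then $\tau_p\text{-}\limsup_{k\to\infty}\Sigma(F,y_k,\beta_k)=\{x^\dagger\}$.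
   Context: $\ell^2(\Lambda)$ is the space of real square-summable families $x=(x_\lambda)_{\lambda\in\Lambda}$, and $\mathcal R_p(x):=\sum_{\lambda\in\Lambda}|x_\lambda|^p\in[0,+\infty]$ for $x\in\ell^2(\Lambda)$; $\ell^p(\Lambda)=\{x:\mathcal R_p(x)<\infty\}$. For $y\in Y$ and $\beta\ge0$, $\Sigma(F,y,\beta)$ denotes the set of solutions of \[ \mathcal R_p(x)\to\min\quad\text{subject to}\quad x\in\ell^2(\Lambda),\ \|Fx-y\|^2\le\beta, \] that is, the set of all feasible $x$ at which $\mathcal R_p$ attains its infimum over the feasible set. $\tau$ is the weak topology on $\ell^2(\Lambda)$, and $\tau_p$ is the topology on $\ell^2(\Lambda)$ generated by all sets $U\cap\{x:\mathcal R_p(x)>s\}$ with $U\in\tau$, $s\in\mathbb R$, and all sets $U\cap\{x:\mathcal R_p(x)<t\}$ with $U\in\tau$, $t\in\mathbb R\cup\{\infty\}$. For a sequence $(\Sigma_k)$ of subsets of $\ell^2(\Lambda)$, $\tau_p\text{-}\limsup_k\Sigma_k:=\bigcap_{k\in\mathbb N}\operatorname{cl}_{\tau_p}\bigl(\bigcup_{k'\ge k}\Sigma_{k'}\bigr)$, where $\operatorname{cl}_{\tau_p}$ is the closure with respect to $\tau_p$. *)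

theory Defs
  imports "HOL-Analysis.Analysis"
begin

text \<open>Families indexed by a set \<open>\<Lambda>\<close> are functions vanishing outside \<open>\<Lambda>\<close>,
  so that every family has exactly one representative. Working with an index set rather
  than an index type includes the case \<open>\<Lambda> = {}\<close>.\<close>

definition ell2 :: "'i set \<Rightarrow> ('i \<Rightarrow> real) set" where
  "ell2 \<Lambda> = {x. (\<forall>i. i \<notin> \<Lambda> \<longrightarrow> x i = 0) \<and> (\<lambda>i. (x i)\<^sup>2) summable_on \<Lambda>}"

definition ell2_norm :: "'i set \<Rightarrow> ('i \<Rightarrow> real) \<Rightarrow> real" where
  "ell2_norm \<Lambda> x = sqrt (\<Sum>\<^sub>\<infinity>i\<in>\<Lambda>. (x i)\<^sup>2)"

text \<open>Values of \<open>F\<close> outside \<open>ell2 \<Lambda>\<close> are irrelevant here and in everything below.\<close>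

definition bounded_linear_ell2 :: "'i set \<Rightarrow> (('i \<Rightarrow> real) \<Rightarrow> 'b::real_normed_vector) \<Rightarrow> bool" where
  "bounded_linear_ell2 \<Lambda> F \<longleftrightarrow>
     (\<forall>x\<in>ell2 \<Lambda>. \<forall>z\<in>ell2 \<Lambda>. F (\<lambda>i. x i + z i) = F x + F z) \<and>
     (\<forall>c. \<forall>x\<in>ell2 \<Lambda>. F (\<lambda>i. c * x i) = c *\<^sub>R F x) \<and>
     (\<exists>K. \<forall>x\<in>ell2 \<Lambda>. norm (F x) \<le> K * ell2_norm \<Lambda> x)"

definition weak_topology_ell2 :: "'i set \<Rightarrow> ('i \<Rightarrow> real) topology" where
  "weak_topology_ell2 \<Lambda> = topology_generated_by
     {{x \<in> ell2 \<Lambda>. f x \<in> V} | (f :: ('i \<Rightarrow> real) \<Rightarrow> real) V. bounded_linear_ell2 \<Lambda> f \<and> open V}"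

text \<open>The terms are nonnegative, so the sum always exists in \<open>[0, \<infinity>]\<close>.\<close>

definition Rp :: "'i set \<Rightarrow> real \<Rightarrow> ('i \<Rightarrow> real) \<Rightarrow> ereal" where
  "Rp \<Lambda> p x = (\<Sum>\<^sub>\<infinity>i\<in>\<Lambda>. ereal (\<bar>x i\<bar> powr p))"

definition ellp :: "'i set \<Rightarrow> real \<Rightarrow> ('i \<Rightarrow> real) set" where
  "ellp \<Lambda> p = {x \<in> ell2 \<Lambda>. Rp \<Lambda> p x < \<infinity>}"

definition tau_p :: "'i set \<Rightarrow> real \<Rightarrow> ('i \<Rightarrow> real) topology" where
  "tau_p \<Lambda> p = topology_generated_by
     ({U \<inter> {x. Rp \<Lambda> p x > ereal s} | U (s::real). openin (weak_topology_ell2 \<Lambda>) U} \<union>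
      {U \<inter> {x. Rp \<Lambda> p x < t} | U (t::ereal). openin (weak_topology_ell2 \<Lambda>) U \<and> t \<noteq> -\<infinity>})"

definition feasible ::
  "'i set \<Rightarrow> (('i \<Rightarrow> real) \<Rightarrow> 'b::real_normed_vector) \<Rightarrow> 'b \<Rightarrow> real \<Rightarrow> ('i \<Rightarrow> real) set" where
  "feasible \<Lambda> F y \<beta> = {x \<in> ell2 \<Lambda>. (norm (F x - y))\<^sup>2 \<le> \<beta>}"

definition reg_solutions ::
  "'i set \<Rightarrow> real \<Rightarrow> (('i \<Rightarrow> real) \<Rightarrow> 'b::real_normed_vector) \<Rightarrow> 'b \<Rightarrow> real \<Rightarrow> ('i \<Rightarrow> real) set" where
  "reg_solutions \<Lambda> p F y \<beta> =
     {x \<in> feasible \<Lambda> F y \<beta>. Rp \<Lambda> p x = (INF z\<in>feasible \<Lambda> F y \<beta>. Rp \<Lambda> p z)}"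

definition top_limsup :: "'a topology \<Rightarrow> (nat \<Rightarrow> 'a set) \<Rightarrow> 'a set" where
  "top_limsup T S = (\<Inter>k. T closure_of (\<Union>k'\<in>{k..}. S k'))"

lemma ell2_add:
  assumes "x \<in> ell2 \<Lambda>" "z \<in> ell2 \<Lambda>"
  shows "(\<lambda>i. x i + z i) \<in> ell2 \<Lambda>"
proof -
  have "(\<lambda>i. 2 * (x i)\<^sup>2 + 2 * (z i)\<^sup>2) summable_on \<Lambda>"
    using assms by (intro summable_on_add summable_on_cmult_right) (auto simp: ell2_def)
  moreover have "(x i + z i)\<^sup>2 \<le> 2 * (x i)\<^sup>2 + 2 * (z i)\<^sup>2" for i
    using zero_le_power2[of "x i - z i"] by (simp add: power2_sum power2_diff)
  ultimately have "(\<lambda>i. (x i + z i)\<^sup>2) summable_on \<Lambda>"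
    by (rule summable_on_comparison_test) auto
  then show ?thesis
    using assms by (auto simp: ell2_def)
qed

lemma ell2_scale: "x \<in> ell2 \<Lambda> \<Longrightarrow> (\<lambda>i. c * x i) \<in> ell2 \<Lambda>"
  by (auto simp: ell2_def power_mult_distrib intro: summable_on_cmult_right)

lemma topspace_weak_topology_ell2: "topspace (weak_topology_ell2 \<Lambda>) = ell2 \<Lambda>"
proof -
  have "bounded_linear_ell2 \<Lambda> (\<lambda>_. 0::real)"
    by (auto simp: bounded_linear_ell2_def intro: exI[of _ 0])
  then have "ell2 \<Lambda> \<in> {{x \<in> ell2 \<Lambda>. f x \<in> V} | (f :: ('a \<Rightarrow> real) \<Rightarrow> real) V.
      bounded_linear_ell2 \<Lambda> f \<and> open V}"
    by (intro CollectI exI[of _ "\<lambda>_. 0"] exI[of _ UNIV]) auto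
  then show ?thesis
    by (auto simp: weak_topology_ell2_def)
qed

lemma Rp_nonneg: "0 \<le> Rp \<Lambda> p x"
  unfolding Rp_def by (rule infsum_nonneg) simp

lemma openin_weak_imp_tau_p:
  assumes "openin (weak_topology_ell2 \<Lambda>) U"
  shows "openin (tau_p \<Lambda> p) U"
proof -
  have "-1 < Rp \<Lambda> p x" for x
    by (rule less_le_trans[OF _ Rp_nonneg]) simp
  then have "U \<inter> {x. Rp \<Lambda> p x > ereal (-1)} = U"
    by (auto simp: one_ereal_def)
  then show ?thesis
    using assms unfolding tau_p_def
    by (intro topology_generated_by_Basis UnI1 CollectI exI[of _ U] exI[of _ "-1"]) auto
qed

lemma topspace_tau_p: "topspace (tau_p \<Lambda> p) = ell2 \<Lambda>"
proof
  show "topspace (tau_p \<Lambda> p) \<subseteq> ell2 \<Lambda>"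
    using openin_subset[of "weak_topology_ell2 \<Lambda>"]
    by (fastforce simp: tau_p_def topspace_weak_topology_ell2)
  show "ell2 \<Lambda> \<subseteq> topspace (tau_p \<Lambda> p)"
    using openin_subset[OF openin_weak_imp_tau_p[OF openin_topspace]]
    by (simp add: topspace_weak_topology_ell2)
qed

end

theory Submission
  imports Defs "HOL-Complex_Analysis.Great_Picard"
begin

text \<open>For \<open>0 < p < 2\<close> a bound on \<open>Rp\<close> bounds the \<open>\<ell>\<^sup>2\<close>-norm, so a sequence with bounded \<open>Rp\<close> has
  a coordinatewise convergent subsequence; being norm bounded, it converges weakly, and \<open>Rp\<close> is lower
  semicontinuous along it by Fatou's argument. Residual constraints are weakly closed, which gives
  existence. For stability and convergence, weak cluster points of regularized solutions are feasible
  for the limit problem, and comparison with nearby feasible competitors bounds their values from above.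
  A \<open>\<tau>\<^sub>p\<close>-cluster point cannot have a larger value than the points approaching it, so it is a
  solution; and along a weakly convergent subsequence the upper bound together with lower
  semicontinuity makes the values of \<open>Rp\<close> converge, so that the convergence is in \<open>\<tau>\<^sub>p\<close>.\<close>

section \<open>Square-summable families\<close>

text \<open>Membership is tested on finite partial sums because such bounds pass to coordinatewise
  limits.\<close>

lemma ell2I:
  assumes "\<And>i. i \<notin> \<Lambda> \<Longrightarrow> x i = 0"
    and "\<And>A. finite A \<Longrightarrow> A \<subseteq> \<Lambda> \<Longrightarrow> (\<Sum>i\<in>A. (x i)\<^sup>2) \<le> C"
  shows "x \<in> ell2 \<Lambda>"
  unfolding ell2_def using assms
  by (auto intro!: nonneg_bdd_above_summable_on bdd_aboveI[of _ C])

lemma ell2_norm_nonneg: "0 \<le> ell2_norm \<Lambda> x"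
  by (auto simp: ell2_norm_def intro!: infsum_nonneg)

lemma ell2_norm_le:
  assumes "x \<in> ell2 \<Lambda>" "0 \<le> C"
    and "\<And>A. finite A \<Longrightarrow> A \<subseteq> \<Lambda> \<Longrightarrow> (\<Sum>i\<in>A. (x i)\<^sup>2) \<le> C\<^sup>2"
  shows "ell2_norm \<Lambda> x \<le> C"
  unfolding ell2_norm_def using assms
  by (intro real_le_lsqrt infsum_le_finite_sums) (auto simp: ell2_def)

lemma ell2_sum_le:
  assumes "x \<in> ell2 \<Lambda>" "finite A" "A \<subseteq> \<Lambda>"
  shows "(\<Sum>i\<in>A. (x i)\<^sup>2) \<le> (ell2_norm \<Lambda> x)\<^sup>2"
proof -
  have "(\<Sum>i\<in>A. (x i)\<^sup>2) \<le> (\<Sum>\<^sub>\<infinity>i\<in>\<Lambda>. (x i)\<^sup>2)"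
    using assms by (intro finite_sum_le_infsum) (auto simp: ell2_def)
  then show ?thesis
    by (simp add: ell2_norm_def infsum_nonneg)
qed

lemma ell2_diff:
  assumes "x \<in> ell2 \<Lambda>" "z \<in> ell2 \<Lambda>"
  shows "(\<lambda>i. x i - z i) \<in> ell2 \<Lambda>"
  using ell2_add[OF assms(1) ell2_scale[OF assms(2), of "-1"]] by simp

text \<open>Choose \<open>A\<close> with partial sum within \<open>\<epsilon>\<^sup>2\<close> of the
  total \<open>s\<close>; a finite set disjoint from \<open>A\<close> can then only use up the
  remainder.\<close>

lemma ell2_tail:
  assumes "x \<in> ell2 \<Lambda>" "\<epsilon> > 0"
  obtains A where "finite A" "A \<subseteq> \<Lambda>"
    "\<And>B. finite B \<Longrightarrow> B \<subseteq> \<Lambda> - A \<Longrightarrow> (\<Sum>i\<in>B. (x i)\<^sup>2) \<le> \<epsilon>\<^sup>2"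
proof -
  define s where "s = (\<Sum>\<^sub>\<infinity>i\<in>\<Lambda>. (x i)\<^sup>2)"
  have sm: "(\<lambda>i. (x i)\<^sup>2) summable_on \<Lambda>"
    using assms by (simp add: ell2_def)
  obtain A where A: "finite A" "A \<subseteq> \<Lambda>" "s - \<epsilon>\<^sup>2 < (\<Sum>i\<in>A. (x i)\<^sup>2)"
  proof (rule ccontr)
    assume "\<not> thesis"
    then have "(\<Sum>i\<in>A. (x i)\<^sup>2) \<le> s - \<epsilon>\<^sup>2" if "finite A" "A \<subseteq> \<Lambda>" for A
      using that \<open>\<And>A. finite A \<Longrightarrow> A \<subseteq> \<Lambda> \<Longrightarrow> s - \<epsilon>\<^sup>2 < (\<Sum>i\<in>A. (x i)\<^sup>2) \<Longrightarrow> thesis\<close>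
      by (meson not_le)
    then have "s \<le> s - \<epsilon>\<^sup>2"
      unfolding s_def by (intro infsum_le_finite_sums sm) auto
    with assms(2) show False by simp
  qed
  have "(\<Sum>i\<in>B. (x i)\<^sup>2) \<le> \<epsilon>\<^sup>2" if B: "finite B" "B \<subseteq> \<Lambda> - A" for B
  proof -
    have "(\<Sum>i\<in>A. (x i)\<^sup>2) + (\<Sum>i\<in>B. (x i)\<^sup>2) = (\<Sum>i\<in>A \<union> B. (x i)\<^sup>2)"
      using A B by (subst sum.union_disjoint) auto
    also have "\<dots> \<le> s"
      unfolding s_def using A B by (intro finite_sum_le_infsum sm) auto
    finally show ?thesis using A(3) by linarith
  qed
  then show thesis using that A by blast
qed

section \<open>Finitely supported families\<close>

definition trunc :: "'i set \<Rightarrow> ('i \<Rightarrow> real) \<Rightarrow> 'i \<Rightarrow> real" where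
  "trunc A x = (\<lambda>i. if i \<in> A then x i else 0)"

definition unit_family :: "'i \<Rightarrow> 'i \<Rightarrow> real" where
  "unit_family i = (\<lambda>j. if j = i then 1 else 0)"

lemma trunc_ell2:
  assumes "finite A" "A \<subseteq> \<Lambda>"
  shows "trunc A x \<in> ell2 \<Lambda>"
proof (rule ell2I)
  fix B assume "finite B" "B \<subseteq> \<Lambda>"
  have "(\<Sum>i\<in>B. (trunc A x i)\<^sup>2) = (\<Sum>i\<in>B \<inter> A. (x i)\<^sup>2)"
    unfolding trunc_def using \<open>finite B\<close> by (subst sum.inter_restrict) (auto intro!: sum.cong)
  also have "\<dots> \<le> (\<Sum>i\<in>A. (x i)\<^sup>2)"
    using assms by (intro sum_mono2) auto
  finally show "(\<Sum>i\<in>B. (trunc A x i)\<^sup>2) \<le> (\<Sum>i\<in>A. (x i)\<^sup>2)" .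
qed (use assms in \<open>auto simp: trunc_def\<close>)

lemma unit_family_ell2: "i \<in> \<Lambda> \<Longrightarrow> unit_family i \<in> ell2 \<Lambda>"
  using trunc_ell2[of "{i}" \<Lambda> "\<lambda>_. 1"] by (simp add: trunc_def unit_family_def)

lemma ell2_norm_trunc_le:
  assumes "finite A" "A \<subseteq> \<Lambda>"
  shows "ell2_norm \<Lambda> (trunc A x) \<le> sqrt (\<Sum>i\<in>A. (x i)\<^sup>2)"
proof (rule ell2_norm_le[OF trunc_ell2[OF assms]])
  fix B assume "finite B" "B \<subseteq> \<Lambda>"
  have "(\<Sum>i\<in>B. (trunc A x i)\<^sup>2) = (\<Sum>i\<in>B \<inter> A. (x i)\<^sup>2)"
    unfolding trunc_def using \<open>finite B\<close> by (subst sum.inter_restrict) (auto intro!: sum.cong)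
  also have "\<dots> \<le> (\<Sum>i\<in>A. (x i)\<^sup>2)"
    using assms by (intro sum_mono2) auto
  finally show "(\<Sum>i\<in>B. (trunc A x i)\<^sup>2) \<le> (sqrt (\<Sum>i\<in>A. (x i)\<^sup>2))\<^sup>2"
    by (simp add: sum_nonneg)
qed (simp add: sum_nonneg)

lemma ell2_norm_trunc_tail:
  assumes "x \<in> ell2 \<Lambda>" "finite A" "A \<subseteq> \<Lambda>" "\<epsilon> \<ge> 0"
    and tail: "\<And>B. finite B \<Longrightarrow> B \<subseteq> \<Lambda> - A \<Longrightarrow> (\<Sum>i\<in>B. (x i)\<^sup>2) \<le> \<epsilon>\<^sup>2"
  shows "ell2_norm \<Lambda> (\<lambda>i. x i - trunc A x i) \<le> \<epsilon>"
proof (rule ell2_norm_le)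
  show "(\<lambda>i. x i - trunc A x i) \<in> ell2 \<Lambda>"
    using assms by (intro ell2_diff trunc_ell2)
  fix B assume B: "finite B" "B \<subseteq> \<Lambda>"
  have "(\<Sum>i\<in>B. (x i - trunc A x i)\<^sup>2) = (\<Sum>i\<in>B - A. (x i)\<^sup>2)"
    unfolding trunc_def using B by (intro sum.mono_neutral_cong_right) auto
  also have "\<dots> \<le> \<epsilon>\<^sup>2"
    using B by (intro tail) auto
  finally show "(\<Sum>i\<in>B. (x i - trunc A x i)\<^sup>2) \<le> \<epsilon>\<^sup>2" .
qed fact

section \<open>Bounded linear maps and the weak topology\<close>

context
  fixes \<Lambda> :: "'i set" and f :: "('i \<Rightarrow> real) \<Rightarrow> 'b::real_normed_vector"
  assumes bl: "bounded_linear_ell2 \<Lambda> f"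
begin

lemma bl_add: "x \<in> ell2 \<Lambda> \<Longrightarrow> z \<in> ell2 \<Lambda> \<Longrightarrow> f (\<lambda>i. x i + z i) = f x + f z"
  using bl by (auto simp: bounded_linear_ell2_def)

lemma bl_scale: "x \<in> ell2 \<Lambda> \<Longrightarrow> f (\<lambda>i. c * x i) = c *\<^sub>R f x"
  using bl by (auto simp: bounded_linear_ell2_def)

lemma bl_diff:
  assumes "x \<in> ell2 \<Lambda>" "z \<in> ell2 \<Lambda>"
  shows "f (\<lambda>i. x i - z i) = f x - f z"
  using bl_add[OF assms(1) ell2_scale[OF assms(2), of "-1"]] bl_scale[OF assms(2), of "-1"]
  by simp

text \<open>The constant in the definition of boundedness may be negative; its absolute value serves
  as well and allows multiplying inequalities by it.\<close>

lemma bl_bound: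
  obtains K where "0 \<le> K" "\<And>x. x \<in> ell2 \<Lambda> \<Longrightarrow> norm (f x) \<le> K * ell2_norm \<Lambda> x"
proof -
  obtain K where K: "\<And>x. x \<in> ell2 \<Lambda> \<Longrightarrow> norm (f x) \<le> K * ell2_norm \<Lambda> x"
    using bl unfolding bounded_linear_ell2_def by blast
  have "norm (f x) \<le> \<bar>K\<bar> * ell2_norm \<Lambda> x" if "x \<in> ell2 \<Lambda>" for x
    using K[OF that] mult_right_mono[OF abs_ge_self[of K] ell2_norm_nonneg[of \<Lambda> x]] by linarith
  then show thesis using that[of "\<bar>K\<bar>"] by simp
qed

lemma bl_trunc:
  assumes "finite A" "A \<subseteq> \<Lambda>"
  shows "f (trunc A x) = (\<Sum>i\<in>A. x i *\<^sub>R f (unit_family i))"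
  using assms
proof (induction A)
  case empty
  \<comment> \<open>The zero family is \<open>0\<close> times any family, so homogeneity gives the
    value \<open>0\<close>.\<close>
  have "f (\<lambda>i. 0 * trunc {} x i) = 0"
    by (subst bl_scale) (auto intro: trunc_ell2)
  then show ?case by (simp add: trunc_def)
next
  case (insert a A)
  have "trunc (insert a A) x = (\<lambda>i. trunc A x i + x a * unit_family a i)"
    using insert by (auto simp: trunc_def unit_family_def)
  then have "f (trunc (insert a A) x) = f (\<lambda>i. trunc A x i + x a * unit_family a i)"
    by simp
  also have "\<dots> = f (trunc A x) + x a *\<^sub>R f (unit_family a)"
    using insert.prems insert.hyps
    by (subst bl_add) (auto simp: bl_scale[OF unit_family_ell2] intro: trunc_ell2 unit_family_ell2 ell2_scale)
  finally show ?case using insert by simp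
qed

text \<open>Truncations converge to \<open>x\<close> in norm and \<open>f\<close> is norm
  continuous. The prescribed \<open>A \<subseteq> B\<close> later lets a fixed finite sum be split
  off.\<close>

lemma bl_approx_trunc:
  assumes "x \<in> ell2 \<Lambda>" "\<epsilon> > 0" "finite A" "A \<subseteq> \<Lambda>"
  obtains B where "finite B" "A \<subseteq> B" "B \<subseteq> \<Lambda>" "norm (f x - f (trunc B x)) < \<epsilon>"
proof -
  obtain K where K: "0 \<le> K" "\<And>x. x \<in> ell2 \<Lambda> \<Longrightarrow> norm (f x) \<le> K * ell2_norm \<Lambda> x"
    using bl_bound by blast
  \<comment> \<open>Dividing by \<open>K + 1\<close> avoids division by zero and makes
    \<open>K * \<delta> < \<epsilon>\<close> strict.\<close>
  define \<delta> where "\<delta> = \<epsilon> / (K + 1)"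
  have \<delta>: "\<delta> > 0" using K assms by (simp add: \<delta>_def)
  obtain C where C: "finite C" "C \<subseteq> \<Lambda>"
    "\<And>B. finite B \<Longrightarrow> B \<subseteq> \<Lambda> - C \<Longrightarrow> (\<Sum>i\<in>B. (x i)\<^sup>2) \<le> \<delta>\<^sup>2"
    using ell2_tail[OF assms(1) \<delta>] by blast
  let ?B = "A \<union> C"
  have B: "finite ?B" "?B \<subseteq> \<Lambda>" using C assms by auto
  have "norm (f x - f (trunc ?B x)) = norm (f (\<lambda>i. x i - trunc ?B x i))"
    by (simp only: bl_diff[OF assms(1) trunc_ell2[OF B]])
  also have "\<dots> \<le> K * ell2_norm \<Lambda> (\<lambda>i. x i - trunc ?B x i)"
    using assms(1) B by (intro K ell2_diff trunc_ell2)
  also have "\<dots> \<le> K * \<delta>"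
    using \<delta> C(3) B assms(1) by (intro mult_left_mono K ell2_norm_trunc_tail) auto
  also have "\<dots> < \<epsilon>"
    using assms(2) K(1) by (simp add: \<delta>_def field_simps)
  finally show thesis using that[of ?B] B by blast
qed

end

section \<open>Bounded functionals and their coefficients\<close>

lemma bl_inner:
  assumes "bounded_linear_ell2 \<Lambda> F"
  shows "bounded_linear_ell2 \<Lambda> (\<lambda>x. F x \<bullet> w)"
proof -
  obtain K where K: "0 \<le> K" "\<And>x. x \<in> ell2 \<Lambda> \<Longrightarrow> norm (F x) \<le> K * ell2_norm \<Lambda> x"
    using bl_bound[OF assms] by blast
  have "norm (F x \<bullet> w) \<le> (K * norm w) * ell2_norm \<Lambda> x" if "x \<in> ell2 \<Lambda>" for x
    using Cauchy_Schwarz_ineq2[of "F x" w] mult_right_mono[OF K(2)[OF that] norm_ge_zero[of w]]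
    by (simp add: algebra_simps)
  then show ?thesis
    using bl_add[OF assms] bl_scale[OF assms]
    by (auto simp: bounded_linear_ell2_def inner_add_left)
qed

text \<open>Apply the functional to the truncation of its own coefficient family: the value is
  \<open>S\<close> and the norm is at most \<open>sqrt S\<close>, whence
  \<open>S \<le> K * sqrt S\<close>.\<close>

lemma functional_coeffs_sum_le:
  fixes f :: "('i \<Rightarrow> real) \<Rightarrow> real"
  assumes bl: "bounded_linear_ell2 \<Lambda> f"
    and K: "0 \<le> K" "\<And>x. x \<in> ell2 \<Lambda> \<Longrightarrow> \<bar>f x\<bar> \<le> K * ell2_norm \<Lambda> x"
    and A: "finite A" "A \<subseteq> \<Lambda>"
  shows "(\<Sum>i\<in>A. (f (unit_family i))\<^sup>2) \<le> K\<^sup>2"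
proof -
  define S where "S = (\<Sum>i\<in>A. (f (unit_family i))\<^sup>2)"
  have S0: "S \<ge> 0" by (simp add: S_def sum_nonneg)
  have "S = f (trunc A (\<lambda>i. f (unit_family i)))"
    unfolding bl_trunc[OF bl A] S_def by (simp add: power2_eq_square)
  also have "\<dots> \<le> K * ell2_norm \<Lambda> (trunc A (\<lambda>i. f (unit_family i)))"
    using K(2)[OF trunc_ell2[OF A]] by (meson abs_le_D1)
  also have "\<dots> \<le> K * sqrt S"
    unfolding S_def using K A by (intro mult_left_mono ell2_norm_trunc_le)
  finally have *: "sqrt S * sqrt S \<le> K * sqrt S" using S0 by (simp only: real_sqrt_mult_self abs_of_nonneg)
  have "sqrt S \<le> K"
  proof (cases "S = 0")
    case False
    with S0 have "0 < sqrt S" by simp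
    with * show ?thesis by (rule mult_right_le_imp_le)
  qed (use K(1) in simp)
  then show ?thesis
    using S0 real_sqrt_le_iff[of S "K\<^sup>2"] K(1) unfolding S_def[symmetric] by simp
qed

text \<open>The coefficients of a bounded functional are square-summable, so by Cauchy-Schwarz the
  coordinates outside a large finite set contribute little.\<close>

lemma functional_uniform_finite_approx:
  fixes f :: "('i \<Rightarrow> real) \<Rightarrow> real"
  assumes bl: "bounded_linear_ell2 \<Lambda> f" and "\<epsilon> > 0"
  obtains A where "finite A" "A \<subseteq> \<Lambda>"
    "\<And>x. x \<in> ell2 \<Lambda> \<Longrightarrow> \<bar>f x - (\<Sum>i\<in>A. x i * f (unit_family i))\<bar> \<le> \<epsilon> * ell2_norm \<Lambda> x"
proof -
  obtain K where K: "0 \<le> K" "\<And>x. x \<in> ell2 \<Lambda> \<Longrightarrow> norm (f x) \<le> K * ell2_norm \<Lambda> x"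
    using bl_bound[OF bl] by blast
  \<comment> \<open>Outside \<open>\<Lambda>\<close> the coefficients are replaced by
    \<open>0\<close>, as membership in \<open>ell2 \<Lambda>\<close> demands.\<close>
  define a where "a = (\<lambda>i. if i \<in> \<Lambda> then f (unit_family i) else 0)"
  have "a \<in> ell2 \<Lambda>"
  proof (rule ell2I)
    fix A assume A: "finite A" "A \<subseteq> \<Lambda>"
    then have "(\<Sum>i\<in>A. (a i)\<^sup>2) = (\<Sum>i\<in>A. (f (unit_family i))\<^sup>2)"
      by (intro sum.cong) (auto simp: a_def)
    then show "(\<Sum>i\<in>A. (a i)\<^sup>2) \<le> K\<^sup>2"
      using functional_coeffs_sum_le[OF bl K(1) _ A] K(2) by simp
  qed (simp add: a_def)
  then obtain A where A: "finite A" "A \<subseteq> \<Lambda>"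
    "\<And>B. finite B \<Longrightarrow> B \<subseteq> \<Lambda> - A \<Longrightarrow> (\<Sum>i\<in>B. (a i)\<^sup>2) \<le> \<epsilon>\<^sup>2"
    using ell2_tail[OF _ \<open>\<epsilon> > 0\<close>] by metis
  have "\<bar>f x - (\<Sum>i\<in>A. x i * f (unit_family i))\<bar> \<le> \<epsilon> * ell2_norm \<Lambda> x" if x: "x \<in> ell2 \<Lambda>" for x
  proof (rule field_le_epsilon)
    \<comment> \<open>\<open>\<delta>\<close> absorbs the error of truncating \<open>x\<close> to a
      finite \<open>B\<close>; what is left is a sum over \<open>B - A\<close>, where the tail bound
      for \<open>a\<close> does not depend on \<open>x\<close>.\<close>
    fix \<delta> :: real assume "\<delta> > 0"
    then obtain B where B: "finite B" "A \<subseteq> B" "B \<subseteq> \<Lambda>" "norm (f x - f (trunc B x)) < \<delta>"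
      using bl_approx_trunc[OF bl x _ A(1,2)] by blast
    have "f (trunc B x) - (\<Sum>i\<in>A. x i * f (unit_family i)) = (\<Sum>i\<in>B - A. x i * f (unit_family i))"
      using B A by (simp add: bl_trunc[OF bl] sum_diff)
    also have "\<dots> = (\<Sum>i\<in>B - A. x i * a i)"
      using B by (intro sum.cong) (auto simp: a_def)
    finally have eq: "f (trunc B x) - (\<Sum>i\<in>A. x i * f (unit_family i)) = (\<Sum>i\<in>B - A. x i * a i)" .
    have "(\<Sum>i\<in>B - A. x i * a i)\<^sup>2 \<le> (\<Sum>i\<in>B - A. (x i)\<^sup>2) * (\<Sum>i\<in>B - A. (a i)\<^sup>2)"
      by (rule Cauchy_Schwarz_ineq_sum)
    also have "\<dots> \<le> (ell2_norm \<Lambda> x)\<^sup>2 * \<epsilon>\<^sup>2"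
      using A B x by (intro mult_mono ell2_sum_le A(3)) (auto intro: sum_nonneg)
    also have "\<dots> = (\<epsilon> * ell2_norm \<Lambda> x)\<^sup>2"
      by (simp add: power_mult_distrib)
    finally have "\<bar>\<Sum>i\<in>B - A. x i * a i\<bar> \<le> \<epsilon> * ell2_norm \<Lambda> x"
      using \<open>\<epsilon> > 0\<close> ell2_norm_nonneg[of \<Lambda> x] by (simp add: abs_le_square_iff[symmetric] abs_mult)
    with B(4) eq show "\<bar>f x - (\<Sum>i\<in>A. x i * f (unit_family i))\<bar> \<le> \<epsilon> * ell2_norm \<Lambda> x + \<delta>"
      by (simp add: abs_if split: if_splits)
  qed
  then show thesis using that A by blast
qed

text \<open>Under a norm bound coordinatewise convergence is enough: up to a small uniform error the
  functional depends on finitely many coordinates.\<close>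

lemma functional_tendsto:
  fixes f :: "('i \<Rightarrow> real) \<Rightarrow> real"
  assumes bl: "bounded_linear_ell2 \<Lambda> f"
    and x: "\<And>n. x n \<in> ell2 \<Lambda>" "\<And>n. ell2_norm \<Lambda> (x n) \<le> M" and l: "l \<in> ell2 \<Lambda>"
    and lim: "\<And>i. i \<in> \<Lambda> \<Longrightarrow> (\<lambda>n. x n i) \<longlonglongrightarrow> l i"
  shows "(\<lambda>n. f (x n)) \<longlonglongrightarrow> f l"
proof (rule LIMSEQ_I)
  fix r :: real assume "r > 0"
  \<comment> \<open>A bound common to all norms, including that of the limit; the summand
    \<open>1\<close> makes it positive, so that dividing by \<open>4 * N\<close> is safe.\<close>
  define N where "N = M + ell2_norm \<Lambda> l + 1"
  have "M \<ge> 0" using ell2_norm_nonneg[of \<Lambda> "x 0"] x(2)[of 0] by linarith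
  then have N: "N > 0" "\<And>n. ell2_norm \<Lambda> (x n) \<le> N" "ell2_norm \<Lambda> l \<le> N"
    using ell2_norm_nonneg[of \<Lambda> l] x(2) by (auto simp: N_def add_increasing2 intro: order_trans)
  obtain A where A: "finite A" "A \<subseteq> \<Lambda>"
    "\<And>x. x \<in> ell2 \<Lambda> \<Longrightarrow> \<bar>f x - (\<Sum>i\<in>A. x i * f (unit_family i))\<bar> \<le> r / (4 * N) * ell2_norm \<Lambda> x"
    using functional_uniform_finite_approx[OF bl, of "r / (4 * N)"] \<open>r > 0\<close> N by auto
  have *: "\<bar>f z - (\<Sum>i\<in>A. z i * f (unit_family i))\<bar> \<le> r / 4"
    if "z \<in> ell2 \<Lambda>" "ell2_norm \<Lambda> z \<le> N" for z
  proof -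
    have "r / (4 * N) * ell2_norm \<Lambda> z \<le> r / (4 * N) * N"
      using that \<open>r > 0\<close> N by (intro mult_left_mono) auto
    also have "\<dots> = r / 4" using N(1) by simp
    finally show ?thesis using A(3)[OF that(1)] by linarith
  qed
  have "(\<lambda>n. \<Sum>i\<in>A. x n i * f (unit_family i)) \<longlonglongrightarrow> (\<Sum>i\<in>A. l i * f (unit_family i))"
    using A by (intro tendsto_sum tendsto_mult_right lim) auto
  from LIMSEQ_D[OF this, of "r / 4"] \<open>r > 0\<close>
  obtain n0 where n0: "\<And>n. n \<ge> n0 \<Longrightarrow>
      norm ((\<Sum>i\<in>A. x n i * f (unit_family i)) - (\<Sum>i\<in>A. l i * f (unit_family i))) < r / 4"
    by auto
  have "norm (f (x n) - f l) < r" if "n \<ge> n0" for n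
    using *[OF x(1) N(2), of n] *[OF l N(3)] n0[OF that] by (simp add: abs_if split: if_splits)
  then show "\<exists>n0. \<forall>n\<ge>n0. norm (f (x n) - f l) < r" by blast
qed

section \<open>Sequential limits in the weak topology and in \<open>tau_p\<close>\<close>

text \<open>Generators suffice: eventual membership survives finite intersections, and a union needs
  only one member containing \<open>l\<close>.\<close>

lemma openin_generated_eventually:
  assumes "openin (topology_generated_by B) U" "l \<in> U"
    and "\<And>S. S \<in> B \<Longrightarrow> l \<in> S \<Longrightarrow> eventually (\<lambda>n. x n \<in> S) F"
  shows "eventually (\<lambda>n. x n \<in> U) F"
  using assms(1)[unfolded openin_topology_generated_by_iff] assms(2,3)
proof (induction rule: generate_topology_on.induct)
  case (Int a b)
  then show ?case by (auto intro: eventually_conj)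
next
  case (UN K)
  then obtain k where "k \<in> K" "l \<in> k" by auto
  with UN have "eventually (\<lambda>n. x n \<in> k) F" by blast
  then show ?case by eventually_elim (use \<open>k \<in> K\<close> in blast)
qed auto

lemma limitin_weakI:
  fixes x :: "nat \<Rightarrow> 'i \<Rightarrow> real"
  assumes "l \<in> ell2 \<Lambda>" "\<And>n. x n \<in> ell2 \<Lambda>"
    and "\<And>f :: ('i \<Rightarrow> real) \<Rightarrow> real. bounded_linear_ell2 \<Lambda> f \<Longrightarrow> (\<lambda>n. f (x n)) \<longlonglongrightarrow> f l"
  shows "limitin (weak_topology_ell2 \<Lambda>) x l sequentially"
  unfolding limitin_def topspace_weak_topology_ell2
proof (intro conjI allI impI)
  fix U assume "openin (weak_topology_ell2 \<Lambda>) U \<and> l \<in> U"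
  then show "eventually (\<lambda>n. x n \<in> U) sequentially"
    unfolding weak_topology_ell2_def
  proof (elim conjE, elim openin_generated_eventually)
    fix S assume "S \<in> {{x \<in> ell2 \<Lambda>. f x \<in> V} |(f :: ('i \<Rightarrow> real) \<Rightarrow> real) V.
      bounded_linear_ell2 \<Lambda> f \<and> open V}" and "l \<in> S"
    then obtain f :: "('i \<Rightarrow> real) \<Rightarrow> real" and V
      where S: "S = {x \<in> ell2 \<Lambda>. f x \<in> V}" "bounded_linear_ell2 \<Lambda> f" "open V" "f l \<in> V"
      by auto
    show "eventually (\<lambda>n. x n \<in> S) sequentially"
      using topological_tendstoD[OF assms(3)[OF S(2)] S(3,4)] assms(2) by (simp add: S(1))
  qed
qed fact

lemma openin_weak_halfspace:
  fixes f :: "('i \<Rightarrow> real) \<Rightarrow> real"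
  assumes "bounded_linear_ell2 \<Lambda> f"
  shows "openin (weak_topology_ell2 \<Lambda>) {x \<in> ell2 \<Lambda>. c < f x}"
  unfolding weak_topology_ell2_def
  using assms
  by (intro topology_generated_by_Basis CollectI exI[of _ f] exI[of _ "{c<..}"]) auto

text \<open>Generators of \<open>tau_p\<close> are weakly open sets cut by strict upper or lower
  level sets of \<open>Rp\<close>; each hypothesis handles one of the two factors.\<close>

lemma limitin_tau_pI:
  assumes weak: "limitin (weak_topology_ell2 \<Lambda>) x l sequentially"
    and R: "(\<lambda>n. Rp \<Lambda> p (x n)) \<longlonglongrightarrow> Rp \<Lambda> p l"
  shows "limitin (tau_p \<Lambda> p) x l sequentially"
  unfolding limitin_def topspace_tau_p
proof (intro conjI allI impI)
  show "l \<in> ell2 \<Lambda>"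
    using weak by (simp add: limitin_def topspace_weak_topology_ell2)
  fix U assume "openin (tau_p \<Lambda> p) U \<and> l \<in> U"
  then show "eventually (\<lambda>n. x n \<in> U) sequentially"
    unfolding tau_p_def
  proof (elim conjE, elim openin_generated_eventually)
    fix S assume S: "S \<in> {U \<inter> {x. Rp \<Lambda> p x > ereal s} | U (s::real). openin (weak_topology_ell2 \<Lambda>) U} \<union>
      {U \<inter> {x. Rp \<Lambda> p x < t} | U (t::ereal). openin (weak_topology_ell2 \<Lambda>) U \<and> t \<noteq> -\<infinity>}" and "l \<in> S"
    have W: "eventually (\<lambda>n. x n \<in> U) sequentially" if "openin (weak_topology_ell2 \<Lambda>) U" "l \<in> U" for U
      using weak that by (simp add: limitin_def)
    show "eventually (\<lambda>n. x n \<in> S) sequentially"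
      using S
    proof
      assume "S \<in> {U \<inter> {x. Rp \<Lambda> p x > ereal s} | U (s::real). openin (weak_topology_ell2 \<Lambda>) U}"
      then show ?thesis
        using \<open>l \<in> S\<close> W order_tendstoD(1)[OF R] by (auto simp: eventually_conj)
    next
      assume "S \<in> {U \<inter> {x. Rp \<Lambda> p x < t} | U (t::ereal). openin (weak_topology_ell2 \<Lambda>) U \<and> t \<noteq> -\<infinity>}"
      then show ?thesis
        using \<open>l \<in> S\<close> W order_tendstoD(2)[OF R] by (auto simp: eventually_conj)
    qed
  qed
qed

text \<open>Taken as a neighbourhood of a cluster point of value above \<open>s\<close>, this set
  must contain approaching solutions of value above \<open>s\<close>.\<close>

lemma openin_tau_p_gt: "openin (tau_p \<Lambda> p) {x \<in> ell2 \<Lambda>. ereal s < Rp \<Lambda> p x}"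
proof -
  have "{x \<in> ell2 \<Lambda>. ereal s < Rp \<Lambda> p x} = topspace (weak_topology_ell2 \<Lambda>) \<inter> {x. ereal s < Rp \<Lambda> p x}"
    by (auto simp: topspace_weak_topology_ell2)
  then show ?thesis
    unfolding tau_p_def
    by (intro topology_generated_by_Basis UnI1 CollectI) blast
qed

section \<open>Weak compactness of the sublevel sets of the regularization functional\<close>

lemma Rp_le_iff:
  "Rp \<Lambda> p x \<le> c \<longleftrightarrow> (\<forall>A. finite A \<longrightarrow> A \<subseteq> \<Lambda> \<longrightarrow> ereal (\<Sum>i\<in>A. \<bar>x i\<bar> powr p) \<le> c)"
  unfolding Rp_def by (subst nonneg_infsum_complete) (auto simp: SUP_le_iff)

lemma sum_le_Rp:
  "finite A \<Longrightarrow> A \<subseteq> \<Lambda> \<Longrightarrow> ereal (\<Sum>i\<in>A. \<bar>x i\<bar> powr p) \<le> Rp \<Lambda> p x"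
  using Rp_le_iff[of \<Lambda> p x "Rp \<Lambda> p x"] by blast

text \<open>Some finite partial sum at \<open>l\<close> already exceeds \<open>c\<close>; it is
  continuous under coordinatewise convergence and is dominated by \<open>Rp\<close> along the
  sequence.\<close>

lemma Rp_lsc:
  assumes lim: "\<And>i. i \<in> \<Lambda> \<Longrightarrow> (\<lambda>n. x n i) \<longlonglongrightarrow> l i" and "0 < p"
    and less: "c < Rp \<Lambda> p l"
  shows "eventually (\<lambda>n. c < Rp \<Lambda> p (x n)) sequentially"
proof -
  obtain A where A: "finite A" "A \<subseteq> \<Lambda>" "c < ereal (\<Sum>i\<in>A. \<bar>l i\<bar> powr p)"
    using less Rp_le_iff[of \<Lambda> p l c] by (meson not_le)
  \<comment> \<open>\<open>0 < p\<close> makes the power continuous at \<open>0\<close> too.\<close>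
  have "(\<lambda>n. \<Sum>i\<in>A. \<bar>x n i\<bar> powr p) \<longlonglongrightarrow> (\<Sum>i\<in>A. \<bar>l i\<bar> powr p)"
    using A \<open>0 < p\<close> by (intro tendsto_sum tendsto_powr' tendsto_rabs lim) auto
  then have "(\<lambda>n. ereal (\<Sum>i\<in>A. \<bar>x n i\<bar> powr p)) \<longlonglongrightarrow> ereal (\<Sum>i\<in>A. \<bar>l i\<bar> powr p)"
    by simp
  from order_tendstoD(1)[OF this A(3)] show ?thesis
    by eventually_elim (use sum_le_Rp[OF A(1,2)] in \<open>blast intro: less_le_trans\<close>)
qed

text \<open>Split \<open>(x i)\<^sup>2\<close> as
  \<open>\<bar>x i\<bar> powr p * \<bar>x i\<bar> powr (2 - p)\<close>. Each single term of
  \<open>Rp\<close> is at most \<open>C\<close>, which bounds the second factor since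
  \<open>2 - p\<close> is positive.\<close>

lemma sum_square_le_Rp:
  assumes "0 < p" "p < 2" "Rp \<Lambda> p x \<le> ereal C" "finite A" "A \<subseteq> \<Lambda>"
  shows "(\<Sum>i\<in>A. (x i)\<^sup>2) \<le> C * C powr ((2 - p) / p)"
proof -
  have S: "(\<Sum>i\<in>B. \<bar>x i\<bar> powr p) \<le> C" if "finite B" "B \<subseteq> \<Lambda>" for B
    using assms(3) that unfolding Rp_le_iff by auto
  have "(x i)\<^sup>2 \<le> \<bar>x i\<bar> powr p * C powr ((2 - p) / p)" if "i \<in> A" for i
  proof -
    have "\<bar>x i\<bar> powr p \<le> C" using S[of "{i}"] that assms by auto
    then have "(\<bar>x i\<bar> powr p) powr ((2 - p) / p) \<le> C powr ((2 - p) / p)"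
      using assms by (intro powr_mono2) auto
    then have "\<bar>x i\<bar> powr (2 - p) \<le> C powr ((2 - p) / p)"
      using assms by (simp add: powr_powr)
    then have "\<bar>x i\<bar> powr p * \<bar>x i\<bar> powr (2 - p) \<le> \<bar>x i\<bar> powr p * C powr ((2 - p) / p)"
      by (intro mult_left_mono) auto
    moreover have "\<bar>x i\<bar> powr p * \<bar>x i\<bar> powr (2 - p) = (x i)\<^sup>2"
      by (cases "x i = 0") (auto simp flip: powr_add)
    ultimately show ?thesis by simp
  qed
  then have "(\<Sum>i\<in>A. (x i)\<^sup>2) \<le> (\<Sum>i\<in>A. \<bar>x i\<bar> powr p * C powr ((2 - p) / p))"
    by (rule sum_mono)
  also have "\<dots> = (\<Sum>i\<in>A. \<bar>x i\<bar> powr p) * C powr ((2 - p) / p)"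
    by (simp add: sum_distrib_right)
  also have "\<dots> \<le> C * C powr ((2 - p) / p)"
    using S assms by (intro mult_right_mono) auto
  finally show ?thesis .
qed

text \<open>All coordinates share one bound, and countability of \<open>\<Lambda>\<close> permits a
  diagonal subsequence. Lower semicontinuity is phrased through levels \<open>c\<close> so that it
  combines with eventual upper bounds.\<close>

lemma Rp_sublevel_compact:
  assumes "countable \<Lambda>" "0 < p" "p < 2"
    and x: "\<And>n. x n \<in> ell2 \<Lambda>" "\<And>n. Rp \<Lambda> p (x n) \<le> ereal C"
  obtains l r where "strict_mono (r :: nat \<Rightarrow> nat)"
    "limitin (weak_topology_ell2 \<Lambda>) (x \<circ> r) l sequentially"
    "\<And>c. c < Rp \<Lambda> p l \<Longrightarrow> eventually (\<lambda>n. c < Rp \<Lambda> p (x (r n))) sequentially"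
proof -
  define M where "M = sqrt (C * C powr ((2 - p) / p))"
  have "0 \<le> C" using order_trans[OF Rp_nonneg x(2)] by simp
  then have M: "0 \<le> M" "M\<^sup>2 = C * C powr ((2 - p) / p)" by (auto simp: M_def)
  have sq: "(\<Sum>i\<in>A. (x n i)\<^sup>2) \<le> M\<^sup>2" if "finite A" "A \<subseteq> \<Lambda>" for n A
    unfolding M using sum_square_le_Rp assms that by blast
  have "norm (x n i) \<le> M" if "i \<in> \<Lambda>" for n i
    using sq[of "{i}" n] that M(1) by (simp add: abs_le_square_iff[symmetric])
  \<comment> \<open>Diagonal subsequence over the countable set \<open>\<Lambda>\<close>, each
    coordinate being bounded by \<open>M\<close>.\<close>
  then obtain r where r: "strict_mono r" "\<And>i. i \<in> \<Lambda> \<Longrightarrow> \<exists>l. (\<lambda>n. x (r n) i) \<longlonglongrightarrow> l"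
    using function_convergent_subsequence[OF \<open>countable \<Lambda>\<close>, of x M] by blast
  define l where "l = (\<lambda>i. if i \<in> \<Lambda> then lim (\<lambda>n. x (r n) i) else 0)"
  have lim: "(\<lambda>n. x (r n) i) \<longlonglongrightarrow> l i" if "i \<in> \<Lambda>" for i
    using r(2)[OF that] that by (auto simp: l_def convergent_def[symmetric] convergent_LIMSEQ_iff)
  have "l \<in> ell2 \<Lambda>"
  proof (rule ell2I)
    fix A assume A: "finite A" "A \<subseteq> \<Lambda>"
    have "(\<lambda>n. \<Sum>i\<in>A. (x (r n) i)\<^sup>2) \<longlonglongrightarrow> (\<Sum>i\<in>A. (l i)\<^sup>2)"
      using A by (intro tendsto_sum tendsto_power lim) auto
    then show "(\<Sum>i\<in>A. (l i)\<^sup>2) \<le> M\<^sup>2"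
      by (rule LIMSEQ_le_const2) (use sq A in blast)
  qed (simp add: l_def)
  have "ell2_norm \<Lambda> (x n) \<le> M" for n
    using sq x M by (intro ell2_norm_le) auto
  then have "limitin (weak_topology_ell2 \<Lambda>) (x \<circ> r) l sequentially"
    using functional_tendsto[of \<Lambda> _ "\<lambda>n. x (r n)" M l] x(1) \<open>l \<in> ell2 \<Lambda>\<close> lim
    by (intro limitin_weakI) auto
  moreover have "eventually (\<lambda>n. c < Rp \<Lambda> p (x (r n))) sequentially" if "c < Rp \<Lambda> p l" for c
    using Rp_lsc[of \<Lambda> "\<lambda>n. x (r n)"] lim that \<open>0 < p\<close> by blast
  ultimately show thesis by (rule that[OF r(1)])
qed

section \<open>Feasible sets and regularized solutions\<close>

text \<open>The residual inequality passes to weak cluster points by testing with the functional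
  \<open>z \<mapsto> \<langle>F z, F x - y\<rangle>\<close>.\<close>

lemma feasible_cluster_point:
  fixes F :: "('i \<Rightarrow> real) \<Rightarrow> 'y::real_inner"
  assumes F: "bounded_linear_ell2 \<Lambda> F"
    and lim: "\<beta>s \<longlonglongrightarrow> \<beta>" "ys \<longlonglongrightarrow> y" and "0 \<le> \<beta>" and x: "x \<in> ell2 \<Lambda>"
    and cl: "\<And>U N. openin (weak_topology_ell2 \<Lambda>) U \<Longrightarrow> x \<in> U \<Longrightarrow>
      \<exists>k\<ge>N. \<exists>z\<in>feasible \<Lambda> F (ys k) (\<beta>s k). z \<in> U"
  shows "x \<in> feasible \<Lambda> F y \<beta>"
proof (rule ccontr)
  assume "x \<notin> feasible \<Lambda> F y \<beta>"
  define w where "w = F x - y"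
  have "sqrt \<beta> < sqrt ((norm w)\<^sup>2)"
    using \<open>x \<notin> feasible \<Lambda> F y \<beta>\<close> x by (intro real_sqrt_less_mono) (auto simp: feasible_def w_def)
  then have w: "sqrt \<beta> < norm w" by simp
  have "norm w > 0" using w \<open>0 \<le> \<beta>\<close> real_sqrt_ge_zero[of \<beta>] by linarith
  then have "sqrt \<beta> * norm w < norm w * norm w"
    using w by simp
  \<comment> \<open>\<open>d\<close> separates \<open>norm w * norm w\<close>, the value of
    \<open>F x - y\<close> tested against \<open>w\<close>, from
    \<open>sqrt \<beta> * norm w\<close>, the largest value that Cauchy-Schwarz allows at a feasible
    point.\<close>
  then obtain d where d: "sqrt \<beta> * norm w < d" "d < norm w * norm w"
    using dense by blast
  define U where "U = {z \<in> ell2 \<Lambda>. d + y \<bullet> w < F z \<bullet> w}"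
  have "norm w * norm w = w \<bullet> w"
    by (simp add: power2_eq_square[symmetric] power2_norm_eq_inner)
  also have "\<dots> = F x \<bullet> w - y \<bullet> w"
    by (simp add: w_def inner_diff_left)
  finally have "x \<in> U" using x d(2) by (simp add: U_def)
  have "openin (weak_topology_ell2 \<Lambda>) U"
    unfolding U_def by (intro openin_weak_halfspace bl_inner F)
  \<comment> \<open>This expression bounds \<open>(F z - y) \<bullet> w\<close> for every
    \<open>z\<close> feasible in the \<open>k\<close>-th problem, so from some \<open>N\<close> on
    no such \<open>z\<close> lies in \<open>U\<close>.\<close>
  have "(\<lambda>k. sqrt (\<beta>s k) * norm w + (ys k - y) \<bullet> w) \<longlonglongrightarrow> sqrt \<beta> * norm w + (y - y) \<bullet> w"
    by (intro tendsto_intros lim)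
  then have "eventually (\<lambda>k. sqrt (\<beta>s k) * norm w + (ys k - y) \<bullet> w < d) sequentially"
    using d(1) by (intro order_tendstoD(2)) auto
  then obtain N where N: "\<And>k. k \<ge> N \<Longrightarrow> sqrt (\<beta>s k) * norm w + (ys k - y) \<bullet> w < d"
    by (auto simp: eventually_sequentially)
  obtain k z where k: "k \<ge> N" "z \<in> feasible \<Lambda> F (ys k) (\<beta>s k)" "z \<in> U"
    using cl[OF \<open>openin _ U\<close> \<open>x \<in> U\<close>] by blast
  have "norm (F z - ys k) \<le> sqrt (\<beta>s k)"
    using k(2) by (intro real_le_rsqrt) (simp add: feasible_def)
  then have "norm (F z - ys k) * norm w \<le> sqrt (\<beta>s k) * norm w"
    by (intro mult_right_mono) auto
  then have "(F z - ys k) \<bullet> w \<le> sqrt (\<beta>s k) * norm w"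
    using norm_cauchy_schwarz[of "F z - ys k" w] by linarith
  then show False
    using N[OF k(1)] k(3) by (simp add: U_def inner_diff_left)
qed

lemma reg_solutions_iff:
  "x \<in> reg_solutions \<Lambda> p F y \<beta> \<longleftrightarrow>
    x \<in> feasible \<Lambda> F y \<beta> \<and> (\<forall>z\<in>feasible \<Lambda> F y \<beta>. Rp \<Lambda> p x \<le> Rp \<Lambda> p z)"
  unfolding reg_solutions_def
  by (auto intro!: antisym INF_lower INF_greatest simp: le_INF_iff)

text \<open>The direct method: a minimizing sequence below the finite value at \<open>x0\<close> has
  a weakly convergent subsequence, whose limit is feasible and minimal.\<close>

lemma reg_solutions_nonempty:
  fixes F :: "('i \<Rightarrow> real) \<Rightarrow> 'y::real_inner"
  assumes "countable \<Lambda>" and F: "bounded_linear_ell2 \<Lambda> F" and p: "0 < p" "p < 2"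
    and x0: "x0 \<in> feasible \<Lambda> F y \<beta>" "Rp \<Lambda> p x0 < \<infinity>"
  shows "reg_solutions \<Lambda> p F y \<beta> \<noteq> {}"
proof -
  \<comment> \<open>Discarding points worse than \<open>x0\<close> keeps the whole minimizing
    sequence in one sublevel set of \<open>Rp\<close>.\<close>
  define \<Phi> where "\<Phi> = {z \<in> feasible \<Lambda> F y \<beta>. Rp \<Lambda> p z \<le> Rp \<Lambda> p x0}"
  obtain C where C: "Rp \<Lambda> p x0 = ereal C"
    using x0(2) Rp_nonneg[of \<Lambda> p x0] by (cases "Rp \<Lambda> p x0") auto
  have "Rp \<Lambda> p ` \<Phi> \<noteq> {}" using x0 by (auto simp: \<Phi>_def)
  from Inf_countable_INF[OF this]
  obtain u where u: "decseq u" "range u \<subseteq> Rp \<Lambda> p ` \<Phi>" "Inf (Rp \<Lambda> p ` \<Phi>) = (INF n. u n)"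
    by (elim exE conjE)
  have "\<exists>z. z \<in> \<Phi> \<and> u n = Rp \<Lambda> p z" for n
    using u(2) by blast
  then have "\<exists>x. \<forall>n. x n \<in> \<Phi> \<and> u n = Rp \<Lambda> p (x n)"
    by (intro choice) blast
  then obtain x where x: "\<And>n. x n \<in> \<Phi>" "\<And>n. u n = Rp \<Lambda> p (x n)"
    by blast
  have xe: "\<And>n. x n \<in> ell2 \<Lambda>" "\<And>n. Rp \<Lambda> p (x n) \<le> ereal C"
    using x(1) C by (auto simp: \<Phi>_def feasible_def)
  obtain l r where r: "strict_mono (r :: nat \<Rightarrow> nat)"
    and l: "limitin (weak_topology_ell2 \<Lambda>) (x \<circ> r) l sequentially"
    and lsc: "\<And>c. c < Rp \<Lambda> p l \<Longrightarrow> eventually (\<lambda>n. c < Rp \<Lambda> p (x (r n))) sequentially"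
    using Rp_sublevel_compact[where x = x, OF \<open>countable \<Lambda>\<close> p xe] by blast
  have "l \<in> feasible \<Lambda> F y \<beta>"
  proof (rule feasible_cluster_point[OF F tendsto_const tendsto_const])
    show "0 \<le> \<beta>"
      using x0(1) by (auto simp: feasible_def intro: order_trans[OF zero_le_power2])
    show "l \<in> ell2 \<Lambda>"
      using l by (simp add: limitin_def topspace_weak_topology_ell2)
    fix U and N :: nat assume "openin (weak_topology_ell2 \<Lambda>) U" "l \<in> U"
    then have "eventually (\<lambda>n. x (r n) \<in> U) sequentially"
      using l by (simp add: limitin_def)
    then obtain n where "x (r n) \<in> U"
      by (auto simp: eventually_sequentially)
    then show "\<exists>k\<ge>N. \<exists>z\<in>feasible \<Lambda> F y \<beta>. z \<in> U"
      using x(1)[of "r n"] by (auto simp: \<Phi>_def)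
  qed
  moreover have "Rp \<Lambda> p l \<le> Inf (Rp \<Lambda> p ` \<Phi>)"
  proof (rule ccontr)
    assume "\<not> ?thesis"
    \<comment> \<open>Along the subsequence the values would eventually be both below and above
      \<open>c\<close>.\<close>
    then obtain c where c: "Inf (Rp \<Lambda> p ` \<Phi>) < c" "c < Rp \<Lambda> p l"
      using dense by (metis not_le)
    have "(u \<circ> r) \<longlonglongrightarrow> Inf (Rp \<Lambda> p ` \<Phi>)"
      unfolding u(3) by (intro LIMSEQ_subseq_LIMSEQ[OF LIMSEQ_INF[OF u(1)] r])
    from order_tendstoD(2)[OF this c(1)] lsc[OF c(2)]
    have "eventually (\<lambda>n. False) sequentially"
      by eventually_elim (use x(2) in \<open>auto dest: less_trans\<close>)
    then show False by simp
  qed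
  then have le: "Rp \<Lambda> p l \<le> Rp \<Lambda> p z" if "z \<in> \<Phi>" for z
    using that by (meson INF_lower order_trans)
  have "Rp \<Lambda> p l \<le> Rp \<Lambda> p z" if "z \<in> feasible \<Lambda> F y \<beta>" for z
  proof (cases "Rp \<Lambda> p z \<le> Rp \<Lambda> p x0")
    case True
    then show ?thesis using that by (intro le) (simp add: \<Phi>_def)
  next
    \<comment> \<open>A feasible point outside \<open>\<Phi>\<close> is worse than
      \<open>x0\<close>, which itself lies in \<open>\<Phi>\<close>.\<close>
    case False
    moreover have "Rp \<Lambda> p l \<le> Rp \<Lambda> p x0"
      using x0 by (intro le) (simp add: \<Phi>_def)
    ultimately show ?thesis by auto
  qed
  ultimately show ?thesis
    unfolding ex_in_conv[symmetric] reg_solutions_iff by blast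
qed

section \<open>Finitely supported and strictly feasible points\<close>

text \<open>Half of the tolerance \<open>sqrt \<beta>\<close> is spent on approximating
  \<open>y\<close> from the dense range, half on truncating the preimage.\<close>

lemma dense_range_trunc:
  fixes F :: "('i \<Rightarrow> real) \<Rightarrow> 'y::real_normed_vector"
  assumes F: "bounded_linear_ell2 \<Lambda> F" and "closure (F ` ell2 \<Lambda>) = UNIV" and "\<beta> > 0"
  obtains A w where "finite A" "A \<subseteq> \<Lambda>" "(norm (F (trunc A w) - y))\<^sup>2 < \<beta>"
proof -
  have e: "sqrt \<beta> / 2 > 0" using \<open>\<beta> > 0\<close> by simp
  have "\<exists>v\<in>F ` ell2 \<Lambda>. dist v y < sqrt \<beta> / 2"
    using assms(2) e closure_approachable[of y "F ` ell2 \<Lambda>"] by (metis UNIV_I)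
  then obtain w where w: "w \<in> ell2 \<Lambda>" "norm (F w - y) < sqrt \<beta> / 2"
    by (auto simp: dist_norm)
  obtain A where A: "finite A" "A \<subseteq> \<Lambda>" "norm (F w - F (trunc A w)) < sqrt \<beta> / 2"
    by (rule bl_approx_trunc[OF F w(1) e finite.emptyI empty_subsetI])
  have "norm (F (trunc A w) - y) < sqrt \<beta>"
    using w(2) A(3) norm_triangle_ineq[of "F (trunc A w) - F w" "F w - y"]
    by (simp add: norm_minus_commute)
  then have "(norm (F (trunc A w) - y))\<^sup>2 < (sqrt \<beta>)\<^sup>2"
    by (intro power_strict_mono) auto
  then show thesis using that A \<open>\<beta> > 0\<close> by simp
qed

lemma Rp_trunc_finite:
  assumes "finite A"
  shows "Rp \<Lambda> p (trunc A x) < \<infinity>"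
proof -
  have "Rp \<Lambda> p (trunc A x) \<le> ereal (\<Sum>i\<in>A. \<bar>x i\<bar> powr p)"
    unfolding Rp_le_iff
  proof (intro allI impI)
    fix B assume "finite B" "B \<subseteq> \<Lambda>"
    have "(\<Sum>i\<in>B. \<bar>trunc A x i\<bar> powr p) = (\<Sum>i\<in>B \<inter> A. \<bar>x i\<bar> powr p)"
      unfolding trunc_def using \<open>finite B\<close> by (subst sum.inter_restrict) (auto intro!: sum.cong)
    also have "\<dots> \<le> (\<Sum>i\<in>A. \<bar>x i\<bar> powr p)"
      using assms by (intro sum_mono2) auto
    finally show "ereal (\<Sum>i\<in>B. \<bar>trunc A x i\<bar> powr p) \<le> ereal (\<Sum>i\<in>A. \<bar>x i\<bar> powr p)"
      by simp
  qed
  then show ?thesis by (rule le_less_trans) simp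
qed

text \<open>Moving from \<open>x\<close> towards a finitely supported \<open>w\<close> scales all but finitely many
  coordinates of \<open>x\<close> by a factor at most \<open>1\<close>, so \<open>Rp\<close> barely increases even when it is not convex.\<close>

lemma strictly_feasible_approx:
  fixes F :: "('i \<Rightarrow> real) \<Rightarrow> 'y::real_normed_vector"
  assumes F: "bounded_linear_ell2 \<Lambda> F" and "0 < p" and A: "finite A" "A \<subseteq> \<Lambda>"
    and w: "(norm (F (trunc A w) - y))\<^sup>2 < \<beta>"
    and x: "x \<in> feasible \<Lambda> F y \<beta>" "Rp \<Lambda> p x < ereal s"
  obtains z where "z \<in> ell2 \<Lambda>" "(norm (F z - y))\<^sup>2 < \<beta>" "Rp \<Lambda> p z < ereal s"
proof -
  define v where "v = trunc A w"
  have v: "v \<in> ell2 \<Lambda>" using A by (simp add: v_def trunc_ell2)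
  have xe: "x \<in> ell2 \<Lambda>" using x by (simp add: feasible_def)
  obtain R where R: "Rp \<Lambda> p x = ereal R" "R < s"
    using x(2) Rp_nonneg[of \<Lambda> p x] by (cases "Rp \<Lambda> p x") auto
  \<comment> \<open>Half of the gap between \<open>R\<close> and \<open>s\<close>, so that
    \<open>R + \<epsilon>\<close> stays strictly below \<open>s\<close>.\<close>
  define \<epsilon> where "\<epsilon> = (s - R) / 2"
  define z where "z = (\<lambda>t i. (1 - t) * x i + t * v i)"
  have "((\<lambda>t. \<Sum>i\<in>A. \<bar>z t i\<bar> powr p) \<longlongrightarrow> (\<Sum>i\<in>A. \<bar>(1 - 0) * x i + 0 * v i\<bar> powr p)) (at_right 0)"
    unfolding z_def using \<open>0 < p\<close> by (intro tendsto_sum tendsto_powr' tendsto_intros) auto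
  then have "eventually (\<lambda>t. (\<Sum>i\<in>A. \<bar>z t i\<bar> powr p) < (\<Sum>i\<in>A. \<bar>x i\<bar> powr p) + \<epsilon>) (at_right 0)"
    using R by (intro order_tendstoD(2)) (auto simp: \<epsilon>_def)
  moreover have "eventually (\<lambda>t::real. 0 < t \<and> t < 1) (at_right 0)"
    by (auto simp: eventually_at_right_field intro: exI[of _ 1])
  ultimately have "eventually (\<lambda>t. 0 < t \<and> t < 1 \<and>
      (\<Sum>i\<in>A. \<bar>z t i\<bar> powr p) < (\<Sum>i\<in>A. \<bar>x i\<bar> powr p) + \<epsilon>) (at_right 0)"
    by eventually_elim auto
  then obtain t where t: "0 < t" "t < 1"
    and zA: "(\<Sum>i\<in>A. \<bar>z t i\<bar> powr p) < (\<Sum>i\<in>A. \<bar>x i\<bar> powr p) + \<epsilon>"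
    using eventually_happens' trivial_limit_at_right_real by (metis (no_types, lifting))
  have "Rp \<Lambda> p (z t) \<le> ereal (R + \<epsilon>)"
    unfolding Rp_le_iff
  proof (intro allI impI)
    fix B assume B: "finite B" "B \<subseteq> \<Lambda>"
    have "\<bar>z t i\<bar> powr p \<le> \<bar>x i\<bar> powr p" if "i \<in> B - A" for i
    proof (rule powr_mono2)
      have "\<bar>z t i\<bar> = (1 - t) * \<bar>x i\<bar>"
        using that t by (simp add: z_def v_def trunc_def abs_mult)
      also have "\<dots> \<le> \<bar>x i\<bar>"
        using t by (intro mult_left_le_one_le) auto
      finally show "\<bar>z t i\<bar> \<le> \<bar>x i\<bar>" .
    qed (use \<open>0 < p\<close> in auto)
    then have BA: "(\<Sum>i\<in>B - A. \<bar>z t i\<bar> powr p) \<le> (\<Sum>i\<in>B - A. \<bar>x i\<bar> powr p)"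
      by (rule sum_mono)
    \<comment> \<open>\<open>B\<close> need not contain \<open>A\<close>; enlarging it to
      \<open>A \<union> B\<close> makes the bound \<open>zA\<close> on the sum over \<open>A\<close>
      applicable.\<close>
    have "(\<Sum>i\<in>B. \<bar>z t i\<bar> powr p) \<le> (\<Sum>i\<in>A \<union> (B - A). \<bar>z t i\<bar> powr p)"
      using A B by (intro sum_mono2) auto
    also have "\<dots> = (\<Sum>i\<in>A. \<bar>z t i\<bar> powr p) + (\<Sum>i\<in>B - A. \<bar>z t i\<bar> powr p)"
      using A B by (intro sum.union_disjoint) auto
    also have "\<dots> \<le> (\<Sum>i\<in>A. \<bar>x i\<bar> powr p) + \<epsilon> + (\<Sum>i\<in>B - A. \<bar>x i\<bar> powr p)"
      using zA BA by linarith
    also have "\<dots> = (\<Sum>i\<in>A \<union> (B - A). \<bar>x i\<bar> powr p) + \<epsilon>"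
      using A B by (subst sum.union_disjoint) auto
    also have "(\<Sum>i\<in>A \<union> (B - A). \<bar>x i\<bar> powr p) \<le> R"
      using sum_le_Rp[of "A \<union> (B - A)" \<Lambda> x p] A B R by auto
    finally show "ereal (\<Sum>i\<in>B. \<bar>z t i\<bar> powr p) \<le> ereal (R + \<epsilon>)" by simp
  qed
  also have "\<dots> < ereal s" using R by (simp add: \<epsilon>_def field_simps)
  finally have Rz: "Rp \<Lambda> p (z t) < ereal s" .
  have ze: "z t \<in> ell2 \<Lambda>"
    unfolding z_def using xe v by (intro ell2_add ell2_scale)
  have "F (z t) = (1 - t) *\<^sub>R F x + t *\<^sub>R F v"
    unfolding z_def by (simp only: bl_add[OF F] bl_scale[OF F] ell2_scale xe v)
  then have "F (z t) - y = (1 - t) *\<^sub>R (F x - y) + t *\<^sub>R (F v - y)"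
    by (simp add: algebra_simps)
  then have "norm (F (z t) - y) \<le> (1 - t) * norm (F x - y) + t * norm (F v - y)"
    using norm_triangle_ineq[of "(1 - t) *\<^sub>R (F x - y)" "t *\<^sub>R (F v - y)"] t by simp
  also have "norm (F x - y) \<le> sqrt \<beta>"
    using x by (intro real_le_rsqrt) (simp add: feasible_def)
  then have "(1 - t) * norm (F x - y) + t * norm (F v - y) \<le> (1 - t) * sqrt \<beta> + t * norm (F v - y)"
    using t by simp
  \<comment> \<open>Strictness comes from the share \<open>t > 0\<close> of the strictly feasible
    \<open>v\<close>.\<close>
  also have "norm (F v - y) < sqrt \<beta>"
    using w by (intro real_less_rsqrt) (simp add: v_def)
  then have "(1 - t) * sqrt \<beta> + t * norm (F v - y) < (1 - t) * sqrt \<beta> + t * sqrt \<beta>"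
    using t by simp
  also have "\<dots> = sqrt \<beta>" by (simp add: algebra_simps)
  finally have "(norm (F (z t) - y))\<^sup>2 < (sqrt \<beta>)\<^sup>2"
    by (intro power_strict_mono) auto
  moreover have "0 \<le> \<beta>" using order_trans[OF zero_le_power2 less_imp_le[OF w]] .
  ultimately have "(norm (F (z t) - y))\<^sup>2 < \<beta>" by simp
  with that ze Rz show thesis by blast
qed

section \<open>Stability and convergence\<close>

text \<open>The hypothesis \<open>recovery\<close> says that the minimal values of the perturbed problems are
  asymptotically not larger than that of the limit problem; it is the only point in which stability
  (\<open>\<beta> > 0\<close>) and convergence (\<open>\<beta> = 0\<close>) differ.\<close>

context
  fixes \<Lambda> :: "'i set" and F :: "('i \<Rightarrow> real) \<Rightarrow> 'y::real_inner" and p \<beta> :: real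
    and \<beta>s :: "nat \<Rightarrow> real" and ys :: "nat \<Rightarrow> 'y" and y :: 'y
  assumes F: "bounded_linear_ell2 \<Lambda> F"
    and lim: "\<beta>s \<longlonglongrightarrow> \<beta>" "ys \<longlonglongrightarrow> y" and \<beta>: "0 \<le> \<beta>"
    and recovery: "\<And>x s. x \<in> feasible \<Lambda> F y \<beta> \<Longrightarrow> Rp \<Lambda> p x < ereal s \<Longrightarrow>
      eventually (\<lambda>k. \<exists>z\<in>feasible \<Lambda> F (ys k) (\<beta>s k). Rp \<Lambda> p z < ereal s) sequentially"
begin

text \<open>Feasibility uses weak neighbourhoods only. If some feasible \<open>z\<close> beat
  \<open>x\<close>, a level \<open>s\<close> between the values would contradict
  \<open>recovery\<close>: solutions close to \<open>x\<close> exceed \<open>s\<close>, while late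
  perturbed problems admit points below \<open>s\<close>.\<close>

lemma top_limsup_reg_solutions_subset:
  "top_limsup (tau_p \<Lambda> p) (\<lambda>k. reg_solutions \<Lambda> p F (ys k) (\<beta>s k)) \<subseteq> reg_solutions \<Lambda> p F y \<beta>"
proof
  fix x assume "x \<in> top_limsup (tau_p \<Lambda> p) (\<lambda>k. reg_solutions \<Lambda> p F (ys k) (\<beta>s k))"
  then have cl: "\<And>N. x \<in> tau_p \<Lambda> p closure_of (\<Union>k\<in>{N..}. reg_solutions \<Lambda> p F (ys k) (\<beta>s k))"
    by (simp add: top_limsup_def)
  then have x: "x \<in> ell2 \<Lambda>"
    by (metis in_closure_of topspace_tau_p)
  have near: "\<exists>k\<ge>N. \<exists>z\<in>reg_solutions \<Lambda> p F (ys k) (\<beta>s k). z \<in> U"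
    if "openin (tau_p \<Lambda> p) U" "x \<in> U" for U N
  proof -
    have "\<exists>z. z \<in> (\<Union>k\<in>{N..}. reg_solutions \<Lambda> p F (ys k) (\<beta>s k)) \<and> z \<in> U"
      using cl[of N] that unfolding in_closure_of by blast
    then show ?thesis by auto
  qed
  have "x \<in> feasible \<Lambda> F y \<beta>"
    using F lim \<beta> x
  proof (rule feasible_cluster_point)
    fix U N assume "openin (weak_topology_ell2 \<Lambda>) U" "x \<in> U"
    then show "\<exists>k\<ge>N. \<exists>z\<in>feasible \<Lambda> F (ys k) (\<beta>s k). z \<in> U"
      using near[OF openin_weak_imp_tau_p] by (meson reg_solutions_iff)
  qed
  moreover have "Rp \<Lambda> p x \<le> Rp \<Lambda> p z" if z: "z \<in> feasible \<Lambda> F y \<beta>" for z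
  proof (rule ccontr)
    assume "\<not> ?thesis"
    then obtain s where s: "Rp \<Lambda> p z < ereal s" "ereal s < Rp \<Lambda> p x"
      using ereal_dense2 by (metis not_le)
    obtain N where N: "\<And>k. k \<ge> N \<Longrightarrow> \<exists>z\<in>feasible \<Lambda> F (ys k) (\<beta>s k). Rp \<Lambda> p z < ereal s"
      using recovery[OF z s(1)] by (auto simp: eventually_sequentially)
    obtain k x' where k: "k \<ge> N" "x' \<in> reg_solutions \<Lambda> p F (ys k) (\<beta>s k)" "ereal s < Rp \<Lambda> p x'"
      using near[OF openin_tau_p_gt, of s N] x s(2) by auto
    then show False
      using N[OF k(1)] unfolding reg_solutions_iff by (meson leD less_trans)
  qed
  ultimately show "x \<in> reg_solutions \<Lambda> p F y \<beta>"
    by (simp add: reg_solutions_iff)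
qed

text \<open>Solutions with bounded values have a weakly convergent subsequence. Applying
  \<open>recovery\<close> at its limit \<open>l\<close> bounds the values from above and lower
  semicontinuity from below, so the convergence is in \<open>tau_p\<close> and \<open>l\<close> lies
  in the closure of every tail.\<close>

lemma top_limsup_reg_solutions_nonempty:
  assumes "countable \<Lambda>" and p: "0 < p" "p < 2"
    and x0: "x0 \<in> feasible \<Lambda> F y \<beta>" "Rp \<Lambda> p x0 < \<infinity>"
  shows "top_limsup (tau_p \<Lambda> p) (\<lambda>k. reg_solutions \<Lambda> p F (ys k) (\<beta>s k)) \<noteq> {}"
proof -
  obtain C where "Rp \<Lambda> p x0 < ereal C"
    using ereal_dense2[OF x0(2)] by blast
  from recovery[OF x0(1) this]
  obtain N where N: "\<And>k. k \<ge> N \<Longrightarrow> \<exists>z\<in>feasible \<Lambda> F (ys k) (\<beta>s k). Rp \<Lambda> p z < ereal C"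
    by (auto simp: eventually_sequentially)
  \<comment> \<open>The shift by \<open>N\<close> skips early problems, which may lack solutions of
    value at most \<open>C\<close>.\<close>
  have "\<exists>x. x \<in> reg_solutions \<Lambda> p F (ys (k + N)) (\<beta>s (k + N)) \<and> Rp \<Lambda> p x \<le> ereal C" for k
  proof -
    obtain z where z: "z \<in> feasible \<Lambda> F (ys (k + N)) (\<beta>s (k + N))" "Rp \<Lambda> p z < ereal C"
      using N[of "k + N"] by auto
    then have "Rp \<Lambda> p z < \<infinity>" by auto
    from reg_solutions_nonempty[OF \<open>countable \<Lambda>\<close> F p z(1) this]
    obtain x where x: "x \<in> reg_solutions \<Lambda> p F (ys (k + N)) (\<beta>s (k + N))" by blast
    with z show ?thesis
      by (meson reg_solutions_iff less_imp_le order_trans)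
  qed
  then have "\<exists>x. \<forall>k. x k \<in> reg_solutions \<Lambda> p F (ys (k + N)) (\<beta>s (k + N)) \<and> Rp \<Lambda> p (x k) \<le> ereal C"
    by (intro choice) blast
  then obtain x where x: "\<And>k. x k \<in> reg_solutions \<Lambda> p F (ys (k + N)) (\<beta>s (k + N))"
    "\<And>k. Rp \<Lambda> p (x k) \<le> ereal C"
    by blast
  have xe: "x k \<in> ell2 \<Lambda>" for k
    using x(1)[of k] by (simp add: reg_solutions_iff feasible_def)
  obtain l r where r: "strict_mono (r :: nat \<Rightarrow> nat)"
    and l: "limitin (weak_topology_ell2 \<Lambda>) (x \<circ> r) l sequentially"
    and lsc: "\<And>c. c < Rp \<Lambda> p l \<Longrightarrow> eventually (\<lambda>n. c < Rp \<Lambda> p (x (r n))) sequentially"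
    using Rp_sublevel_compact[where x = x, OF \<open>countable \<Lambda>\<close> p xe x(2)] by blast
  \<comment> \<open>Hence the subsequence reaches every tail of the sequence of problems.\<close>
  have r_ge: "n \<le> r n + N" for n
    using seq_suble[OF r, of n] by simp
  have l_feasible: "l \<in> feasible \<Lambda> F y \<beta>"
    using F lim \<beta>
  proof (rule feasible_cluster_point)
    show "l \<in> ell2 \<Lambda>"
      using l by (simp add: limitin_def topspace_weak_topology_ell2)
    fix U M assume "openin (weak_topology_ell2 \<Lambda>) U" "l \<in> U"
    then have "eventually (\<lambda>n. x (r n) \<in> U) sequentially"
      using l by (simp add: limitin_def)
    then obtain n0 where "\<And>n. n \<ge> n0 \<Longrightarrow> x (r n) \<in> U"
      by (auto simp: eventually_sequentially)
    then obtain n where "n \<ge> M" "x (r n) \<in> U"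
      by (meson max.cobounded1 max.cobounded2)
    then show "\<exists>k\<ge>M. \<exists>z\<in>feasible \<Lambda> F (ys k) (\<beta>s k). z \<in> U"
      using x(1)[of "r n"] r_ge[of n] by (intro exI[of _ "r n + N"]) (auto simp: reg_solutions_iff)
  qed
  have "(\<lambda>n. Rp \<Lambda> p ((x \<circ> r) n)) \<longlonglongrightarrow> Rp \<Lambda> p l"
  proof (rule order_tendstoI)
    fix b assume "Rp \<Lambda> p l < b"
    then obtain s where s: "Rp \<Lambda> p l < ereal s" "ereal s < b"
      using ereal_dense2 by blast
    \<comment> \<open>\<open>recovery\<close> at \<open>l\<close> itself: late solutions cannot have
      values above \<open>s\<close>.\<close>
    obtain M where M: "\<And>k. k \<ge> M \<Longrightarrow> \<exists>z\<in>feasible \<Lambda> F (ys k) (\<beta>s k). Rp \<Lambda> p z < ereal s"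
      using recovery[OF l_feasible s(1)] by (auto simp: eventually_sequentially)
    have "Rp \<Lambda> p (x (r n)) < b" if n: "n \<ge> M" for n
    proof -
      obtain z where "z \<in> feasible \<Lambda> F (ys (r n + N)) (\<beta>s (r n + N))" "Rp \<Lambda> p z < ereal s"
        using M[of "r n + N"] n r_ge[of n] by auto
      then show ?thesis
        using x(1)[of "r n"] s(2) unfolding reg_solutions_iff by (meson le_less_trans less_trans)
    qed
    then show "eventually (\<lambda>n. Rp \<Lambda> p ((x \<circ> r) n) < b) sequentially"
      by (auto simp: eventually_sequentially)
  qed (use lsc in simp)
  with l have tau: "limitin (tau_p \<Lambda> p) (x \<circ> r) l sequentially"
    by (rule limitin_tau_pI)
  have "l \<in> tau_p \<Lambda> p closure_of (\<Union>k\<in>{K..}. reg_solutions \<Lambda> p F (ys k) (\<beta>s k))" for K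
    unfolding in_closure_of
  proof (intro conjI allI impI)
    show "l \<in> topspace (tau_p \<Lambda> p)"
      using tau by (simp add: limitin_def)
    fix U assume "l \<in> U \<and> openin (tau_p \<Lambda> p) U"
    then have "eventually (\<lambda>n. x (r n) \<in> U) sequentially"
      using tau by (simp add: limitin_def)
    then obtain n0 where "\<And>n. n \<ge> n0 \<Longrightarrow> x (r n) \<in> U"
      by (auto simp: eventually_sequentially)
    then obtain n where "n \<ge> K" "x (r n) \<in> U"
      by (meson max.cobounded1 max.cobounded2)
    then show "\<exists>z. z \<in> (\<Union>k\<in>{K..}. reg_solutions \<Lambda> p F (ys k) (\<beta>s k)) \<and> z \<in> U"
      using x(1)[of "r n"] r_ge[of n]
      by (intro exI[of _ "x (r n)"] conjI UN_I[of "r n + N"]) auto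
  qed
  then show ?thesis by (auto simp: top_limsup_def)
qed

end

section \<open>Recovery of competitors under perturbed data\<close>

text \<open>Strict feasibility persists under small changes of \<open>\<beta>\<close> and
  \<open>y\<close>, so a single strictly feasible \<open>z\<close> serves all late
  \<open>k\<close>.\<close>

lemma recovery_positive:
  fixes F :: "('i \<Rightarrow> real) \<Rightarrow> 'y::real_normed_vector"
  assumes F: "bounded_linear_ell2 \<Lambda> F" "closure (F ` ell2 \<Lambda>) = UNIV" and "0 < p" "0 < \<beta>"
    and lim: "\<beta>s \<longlonglongrightarrow> \<beta>" "ys \<longlonglongrightarrow> y"
    and x: "x \<in> feasible \<Lambda> F y \<beta>" "Rp \<Lambda> p x < ereal s"
  shows "eventually (\<lambda>k. \<exists>z\<in>feasible \<Lambda> F (ys k) (\<beta>s k). Rp \<Lambda> p z < ereal s) sequentially"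
proof -
  obtain A w where "finite A" "A \<subseteq> \<Lambda>" "(norm (F (trunc A w) - y))\<^sup>2 < \<beta>"
    by (rule dense_range_trunc[OF F \<open>0 < \<beta>\<close>])
  then obtain z where z: "z \<in> ell2 \<Lambda>" "(norm (F z - y))\<^sup>2 < \<beta>" "Rp \<Lambda> p z < ereal s"
    using strictly_feasible_approx[OF F(1) \<open>0 < p\<close> _ _ _ x] by blast
  have "(\<lambda>k. \<beta>s k - (norm (F z - ys k))\<^sup>2) \<longlonglongrightarrow> \<beta> - (norm (F z - y))\<^sup>2"
    by (intro tendsto_intros lim)
  then have "eventually (\<lambda>k. 0 < \<beta>s k - (norm (F z - ys k))\<^sup>2) sequentially"
    using z(2) by (intro order_tendstoD(1)) auto
  then show ?thesis
    by eventually_elim (use z in \<open>auto simp: feasible_def intro!: bexI[of _ z]\<close>)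
qed

text \<open>The solution \<open>x\<close> of \<open>F x = y\<close> is itself a competitor: its
  residual is at most \<open>\<beta>s k\<close>, and squaring does not increase this bound once
  \<open>\<beta>s k < 1\<close>.\<close>

lemma recovery_zero:
  fixes F :: "('i \<Rightarrow> real) \<Rightarrow> 'y::real_normed_vector"
  assumes bound: "\<And>k. norm (ys k - y) \<le> \<beta>s k" and lim: "\<beta>s \<longlonglongrightarrow> 0"
    and x: "x \<in> feasible \<Lambda> F y 0" "Rp \<Lambda> p x < ereal s"
  shows "eventually (\<lambda>k. \<exists>z\<in>feasible \<Lambda> F (ys k) (\<beta>s k). Rp \<Lambda> p z < ereal s) sequentially"
proof -
  have Fx: "x \<in> ell2 \<Lambda>" "F x = y"
    using x by (auto simp: feasible_def)
  have "eventually (\<lambda>k. \<beta>s k < 1) sequentially"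
    using lim by (rule order_tendstoD(2)) simp
  then show ?thesis
  proof eventually_elim
    case (elim k)
    have b: "0 \<le> \<beta>s k" using bound[of k] norm_ge_zero order_trans by blast
    have "(norm (F x - ys k))\<^sup>2 \<le> (\<beta>s k)\<^sup>2"
      using bound[of k] Fx by (intro power_mono) (auto simp: norm_minus_commute)
    also have "\<dots> \<le> \<beta>s k"
      using b elim by (simp add: power2_eq_square mult_left_le)
    finally show ?case using Fx x(2) by (auto simp: feasible_def)
  qed
qed

theorem proposition6p2:
  fixes \<Lambda> :: "'i set"
    and F :: "('i \<Rightarrow> real) \<Rightarrow> 'y::{real_inner, complete_space}"
    and p :: real
  assumes "countable \<Lambda>"
    and "bounded_linear_ell2 \<Lambda> F"
    and "closure (F ` ell2 \<Lambda>) = UNIV"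
    and "0 < p" and "p < 2"
  shows
    "(\<forall>\<beta>>0. \<forall>y. reg_solutions \<Lambda> p F y \<beta> \<noteq> {}) \<and>
     (\<forall>(\<beta>s :: nat \<Rightarrow> real) \<beta> (ys :: nat \<Rightarrow> 'y) y.
        \<beta>s \<longlonglongrightarrow> \<beta> \<and> \<beta> > 0 \<and> ys \<longlonglongrightarrow> y \<longrightarrow>
          top_limsup (tau_p \<Lambda> p) (\<lambda>k. reg_solutions \<Lambda> p F (ys k) (\<beta>s k)) \<noteq> {} \<and>
          top_limsup (tau_p \<Lambda> p) (\<lambda>k. reg_solutions \<Lambda> p F (ys k) (\<beta>s k))
            \<subseteq> reg_solutions \<Lambda> p F y \<beta>) \<and>
     (\<forall>(\<beta>s :: nat \<Rightarrow> real) (ys :: nat \<Rightarrow> 'y) y.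
        (\<forall>k. norm (ys k - y) \<le> \<beta>s k) \<and> \<beta>s \<longlonglongrightarrow> 0 \<and> (\<exists>x\<in>ellp \<Lambda> p. F x = y) \<longrightarrow>
          top_limsup (tau_p \<Lambda> p) (\<lambda>k. reg_solutions \<Lambda> p F (ys k) (\<beta>s k)) \<noteq> {} \<and>
          top_limsup (tau_p \<Lambda> p) (\<lambda>k. reg_solutions \<Lambda> p F (ys k) (\<beta>s k))
            \<subseteq> reg_solutions \<Lambda> p F y 0 \<and>
          (\<forall>xd. reg_solutions \<Lambda> p F y 0 = {xd} \<longrightarrow>
             top_limsup (tau_p \<Lambda> p) (\<lambda>k. reg_solutions \<Lambda> p F (ys k) (\<beta>s k)) = {xd}))"
proof (intro conjI allI impI)
  \<comment> \<open>Density of the range supplies a finitely supported feasible point for every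
    positive tolerance.\<close>
  have finite_point: "\<exists>x\<in>feasible \<Lambda> F y \<beta>. Rp \<Lambda> p x < \<infinity>" if pos: "\<beta> > 0" for \<beta> y
  proof -
    obtain A w where A: "finite A" "A \<subseteq> \<Lambda>" "(norm (F (trunc A w) - y))\<^sup>2 < \<beta>"
      by (rule dense_range_trunc[OF assms(2,3) pos])
    then show ?thesis
      by (intro bexI[of _ "trunc A w"] Rp_trunc_finite) (auto simp: feasible_def trunc_ell2)
  qed
  show "reg_solutions \<Lambda> p F y \<beta> \<noteq> {}" if "\<beta> > 0" for \<beta> y
    using finite_point[OF that, of y] reg_solutions_nonempty[OF assms(1,2,4,5)] by blast
  fix \<beta>s :: "nat \<Rightarrow> real" and \<beta> and ys :: "nat \<Rightarrow> 'y" and y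
  assume *: "\<beta>s \<longlonglongrightarrow> \<beta> \<and> \<beta> > 0 \<and> ys \<longlonglongrightarrow> y"
  then have lim: "\<beta>s \<longlonglongrightarrow> \<beta>" "ys \<longlonglongrightarrow> y" and \<beta>: "0 < \<beta>" by auto
  note recovery = recovery_positive[OF assms(2-4) \<beta> lim]
  obtain x0 where x0: "x0 \<in> feasible \<Lambda> F y \<beta>" "Rp \<Lambda> p x0 < \<infinity>"
    using finite_point[OF \<beta>] by blast
  show "top_limsup (tau_p \<Lambda> p) (\<lambda>k. reg_solutions \<Lambda> p F (ys k) (\<beta>s k)) \<noteq> {}"
    by (rule top_limsup_reg_solutions_nonempty[OF assms(2) lim less_imp_le[OF \<beta>] recovery assms(1,4,5) x0])
  show "top_limsup (tau_p \<Lambda> p) (\<lambda>k. reg_solutions \<Lambda> p F (ys k) (\<beta>s k)) \<subseteq> reg_solutions \<Lambda> p F y \<beta>"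
    by (rule top_limsup_reg_solutions_subset[OF assms(2) lim less_imp_le[OF \<beta>] recovery])
next
  fix \<beta>s :: "nat \<Rightarrow> real" and ys :: "nat \<Rightarrow> 'y" and y
  assume *: "(\<forall>k. norm (ys k - y) \<le> \<beta>s k) \<and> \<beta>s \<longlonglongrightarrow> 0 \<and> (\<exists>x\<in>ellp \<Lambda> p. F x = y)"
  let ?L = "top_limsup (tau_p \<Lambda> p) (\<lambda>k. reg_solutions \<Lambda> p F (ys k) (\<beta>s k))"
  have lim: "\<beta>s \<longlonglongrightarrow> 0" using * by blast
  have "(\<lambda>k. ys k - y) \<longlonglongrightarrow> 0"
    using * by (intro Lim_null_comparison[OF _ lim]) auto
  then have ys: "ys \<longlonglongrightarrow> y"
    by (simp add: LIM_zero_iff)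
  have recovery: "eventually (\<lambda>k. \<exists>z\<in>feasible \<Lambda> F (ys k) (\<beta>s k). Rp \<Lambda> p z < ereal s) sequentially"
    if "x \<in> feasible \<Lambda> F y 0" "Rp \<Lambda> p x < ereal s" for x s
    using * that by (intro recovery_zero) auto
  \<comment> \<open>The assumed solution in \<open>ellp \<Lambda> p\<close> has zero residual and
    finite value.\<close>
  obtain x0 where x0: "x0 \<in> feasible \<Lambda> F y 0" "Rp \<Lambda> p x0 < \<infinity>"
    using * by (auto simp: ellp_def feasible_def)
  show nonempty: "?L \<noteq> {}"
    by (rule top_limsup_reg_solutions_nonempty[OF assms(2) lim ys order_refl recovery assms(1,4,5) x0])
  show sub: "?L \<subseteq> reg_solutions \<Lambda> p F y 0"
    by (rule top_limsup_reg_solutions_subset[OF assms(2) lim ys order_refl recovery])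
  show "?L = {xd}" if "reg_solutions \<Lambda> p F y 0 = {xd}" for xd
    using nonempty subset_singletonD[OF sub[unfolded that]] by simp
qed

end
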